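(* Let $n\ge 1$, $\pi\in\mathcal{S}_n$, and $\sigma=\Psi(\pi)$. Then $$\mathrm{des}\,\pi=\mathrm{wex}\,\sigma-1,$$ $$(31\text{-}2)\pi=A_{EE}(\sigma)+A_{NN}(\sigma),$$ $$(21\text{-}3)\pi+(3\text{-}21)\pi-\binom{\mathrm{des}\,\pi}{2}=A_{EN}(\sigma),$$ $$(2\text{-}31)\pi=C_{EE}(\sigma)+C_{NN}(\sigma),$$ $$(1\text{-}32)\pi+(32\text{-}1)\pi-\binom{\mathrm{des}\,\pi}{2}=A_{NE}(\sigma).$$
   Context: Permutations $\pi=a_1\cdots a_n\in\mathcal{S}_n$ are in one-line notation. A descent is an index $i$ with $a_i>a_{i+1}$; then $a_i$ is a descent top and $a_{i+1}$ a descent bottom; $\mathrm{des}\,\pi$ is the number of descents. $\mathrm{wex}\,\sigma$ is the number of $i$ with $\sigma(i)\ge i$. **Generalized patterns.** For a pattern $p$ (a permutation of $1,2,3$ written with a dash between some adjacent letters), $(p)\pi$ denotes the number of occurrences of $p$ in $\pi$: subsequences of $\pi$ of length $3$ whose letters are in the same relative order as those of $p$, where letters of $p$ not separated by a dash must correspond to adjacent letters of $\pi$ (a dash imposes no adjacency restriction). **Alignments and crossings.** For $\sigma=s_1\cdots s_n$: $A_{EE}(i)=\{j: j<i\le s_i<s_j\}$, $A_{NN}(i)=\{j: s_j<s_i<i<j\}$, $A_{EN}(i)=\{j: j\le s_j<s_i<i\}$, $A_{NE}(i)=\{j: s_i<i<j\le s_j\}$, $C_{EE}(i)=\{j: j<i\le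 s_j<s_i\}$, $C_{NN}(i)=\{j: s_i<s_j<i<j\}$; $A_{EE}(\sigma)=\sum_i|A_{EE}(i)|$ and likewise for the others. **The map $\Psi:\mathcal{S}_n\to\mathcal{S}_n$.** For a letter $\ell$ of $\pi$, the right embracing number $\mathrm{rembr}(\ell)$ is the number of descents $\cdots yx\cdots$ (consecutive letters $y>x$) to the right of $\ell$ in $\pi$ with $x<\ell<y$. Let $F$ be the set obtained by adding $1$ to each descent bottom of $\pi$ and adjoining $1$; $F'$ the set obtained by subtracting $1$ from each descent top and adjoining $n$; $G$ the set obtained from the letters that are not descent bottoms by removing $n$ and adding $1$ to each remaining letter; $G'$ the set obtained from the letters that are not descent tops by removing $1$ and subtracting $1$ from each remaining letter. Define $\tau=\Psi(\pi)$ as follows. Process the elements $b$ of $F$ in decreasing order, letting $\tau(b)$ be the not-yet-used element $t\ge b$ of $F'$ such that exactly $\mathrm{rembr}(b)$ of the not-yet-used elements $x\in F'$ satisfy $b\le x<t$. Then process the elements $b$ of $G$ in increasing order, letting $\tau(b)$ be the not-yet-used element $d<b$ of $G'$ such that exactly $\mathrm{rembr}(b)$ of the not-yet-used elements $x\in G'$ satisfy $d<x<b$. (These choices can always be made, and $\Psi$ is a well-defined map.) *)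

theory Defs
  imports "HOL-Combinatorics.Permutations"
begin

(* A permutation of {1..n} is a function p with  p permutes {1..n};  its one-line notation
   is the word p 1, p 2, ..., p n. *)

definition descents :: "nat \<Rightarrow> (nat \<Rightarrow> nat) \<Rightarrow> nat set" where
  "descents n p = {i. 1 \<le> i \<and> i < n \<and> p i > p (i + 1)}"

definition descent_tops :: "nat \<Rightarrow> (nat \<Rightarrow> nat) \<Rightarrow> nat set" where
  "descent_tops n p = {p i | i. i \<in> descents n p}"

definition descent_bottoms :: "nat \<Rightarrow> (nat \<Rightarrow> nat) \<Rightarrow> nat set" where
  "descent_bottoms n p = {p (i + 1) | i. i \<in> descents n p}"

definition des :: "nat \<Rightarrow> (nat \<Rightarrow> nat) \<Rightarrow> nat" where
  "des n p = card (descents n p)"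

definition wex :: "nat \<Rightarrow> (nat \<Rightarrow> nat) \<Rightarrow> nat" where
  "wex n s = card {i \<in> {1..n}. s i \<ge> i}"

(* How consecutive letters of a pattern are joined: Adj if they are written without a dash. *)

datatype link = Adj | Dash

(* occurrences n a g b h c p  is the number of occurrences in p of the pattern with letters
   a, b, c, joined by g (between a and b) and h (between b and c).  For example, (31-2)p is
   occurrences n 3 Adj 1 Dash 2 p. *)

definition occurrences ::
    "nat \<Rightarrow> nat \<Rightarrow> link \<Rightarrow> nat \<Rightarrow> link \<Rightarrow> nat \<Rightarrow> (nat \<Rightarrow> nat) \<Rightarrow> nat" where
  "occurrences n a g b h c p =
     card {(i, j, k). 1 \<le> i \<and> i < j \<and> j < k \<and> k \<le> n \<and>
       (g = Adj \<longrightarrow> j = i + 1) \<and> (h = Adj \<longrightarrow> k = j + 1) \<and>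
       (p i < p j \<longleftrightarrow> a < b) \<and> (p i < p k \<longleftrightarrow> a < c) \<and> (p j < p k \<longleftrightarrow> b < c)}"

definition A_EE :: "nat \<Rightarrow> (nat \<Rightarrow> nat) \<Rightarrow> nat" where
  "A_EE n s = (\<Sum>i=1..n. card {j \<in> {1..n}. j < i \<and> i \<le> s i \<and> s i < s j})"

definition A_NN :: "nat \<Rightarrow> (nat \<Rightarrow> nat) \<Rightarrow> nat" where
  "A_NN n s = (\<Sum>i=1..n. card {j \<in> {1..n}. s j < s i \<and> s i < i \<and> i < j})"

definition A_EN :: "nat \<Rightarrow> (nat \<Rightarrow> nat) \<Rightarrow> nat" where
  "A_EN n s = (\<Sum>i=1..n. card {j \<in> {1..n}. j \<le> s j \<and> s j < s i \<and> s i < i})"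

definition A_NE :: "nat \<Rightarrow> (nat \<Rightarrow> nat) \<Rightarrow> nat" where
  "A_NE n s = (\<Sum>i=1..n. card {j \<in> {1..n}. s i < i \<and> i < j \<and> j \<le> s j})"

definition C_EE :: "nat \<Rightarrow> (nat \<Rightarrow> nat) \<Rightarrow> nat" where
  "C_EE n s = (\<Sum>i=1..n. card {j \<in> {1..n}. j < i \<and> i \<le> s j \<and> s j < s i})"

definition C_NN :: "nat \<Rightarrow> (nat \<Rightarrow> nat) \<Rightarrow> nat" where
  "C_NN n s = (\<Sum>i=1..n. card {j \<in> {1..n}. s i < s j \<and> s j < i \<and> i < j})"

(* The letter l stands at position inv p l. *)

definition rembr :: "nat \<Rightarrow> (nat \<Rightarrow> nat) \<Rightarrow> nat \<Rightarrow> nat" where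
  "rembr n p l = card {i \<in> descents n p. inv p l < i \<and> p (i + 1) < l \<and> l < p i}"

definition F_set :: "nat \<Rightarrow> (nat \<Rightarrow> nat) \<Rightarrow> nat set" where
  "F_set n p = insert 1 ((\<lambda>x. x + 1) ` descent_bottoms n p)"

definition F'_set :: "nat \<Rightarrow> (nat \<Rightarrow> nat) \<Rightarrow> nat set" where
  "F'_set n p = insert n ((\<lambda>x. x - 1) ` descent_tops n p)"

definition G_set :: "nat \<Rightarrow> (nat \<Rightarrow> nat) \<Rightarrow> nat set" where
  "G_set n p = (\<lambda>x. x + 1) ` ({1..n} - descent_bottoms n p - {n})"

definition G'_set :: "nat \<Rightarrow> (nat \<Rightarrow> nat) \<Rightarrow> nat set" where
  "G'_set n p = (\<lambda>x. x - 1) ` ({1..n} - descent_tops n p - {1})"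

(* Choice of the value at b when U is the set of values not yet used.  At most one t satisfies
   each condition; when Psi is computed for a permutation, exactly one does. *)

definition choose_F :: "nat \<Rightarrow> (nat \<Rightarrow> nat) \<Rightarrow> nat \<Rightarrow> nat set \<Rightarrow> nat" where
  "choose_F n p b U = (THE t. t \<in> U \<and> b \<le> t \<and> card {x \<in> U. b \<le> x \<and> x < t} = rembr n p b)"

definition choose_G :: "nat \<Rightarrow> (nat \<Rightarrow> nat) \<Rightarrow> nat \<Rightarrow> nat set \<Rightarrow> nat" where
  "choose_G n p b U = (THE d. d \<in> U \<and> d < b \<and> card {x \<in> U. d < x \<and> x < b} = rembr n p b)"

(* Process the arguments in the given order, removing each chosen value from U. *)

primrec assign ::
    "(nat \<Rightarrow> nat set \<Rightarrow> nat) \<Rightarrow> nat list \<Rightarrow> nat set \<Rightarrow> (nat \<Rightarrow> nat) \<Rightarrow> (nat \<Rightarrow> nat)" where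
  "assign ch [] U s = s"
| "assign ch (b # bs) U s = (let t = ch b U in assign ch bs (U - {t}) (s(b := t)))"

(* F_set and G_set partition {1..n}; outside {1..n} the result is the identity. *)

definition Psi :: "nat \<Rightarrow> (nat \<Rightarrow> nat) \<Rightarrow> (nat \<Rightarrow> nat)" where
  "Psi n p =
     assign (choose_G n p) (sorted_list_of_set (G_set n p)) (G'_set n p)
       (assign (choose_F n p) (rev (sorted_list_of_set (F_set n p))) (F'_set n p) id)"

end

theory Submission
  imports Defs
begin

text \<open>
  Let \<open>e i\<close> be the number of descents \<open>y x\<close> with \<open>x < i < y\<close>; it splits into those to the right
  of \<open>i\<close> (\<open>rembr\<close>) and those to its left.  Counting descent bottoms and tops below \<open>i\<close> gives
  \<open>card {j \<in> F. j \<le> i} = 1 + e i + card {t \<in> F'. t < i}\<close>.  This makes every choice in \<open>\<Psi>\<close>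
  possible, and it says that each \<open>i\<close> has exactly \<open>e i\<close> crossings and alignments of the types
  EE and NN.  By the choice rule \<open>rembr i\<close> of them are crossings, because the values unused when
  \<open>i\<close> is processed are exactly those taken by later arguments; the other ones are the alignments.
  The numbers \<open>A_EN\<close> and \<open>A_NE\<close> depend only on the value sets \<open>F'\<close>, \<open>G'\<close> and on the argument
  sets \<open>F\<close>, \<open>G\<close>, respectively, so they count pairs of a descent top (bottom) and a larger
  (smaller) letter that is not one; the pairs of two tops (bottoms) account for the binomial
  coefficient.
\<close>

section \<open>Greedy assignments\<close>

text \<open>Proved for an arbitrary linear order so that it also applies to the reversed one: the
  arguments in \<open>F\<close> choose values counting upwards, those in \<open>G\<close> counting
  downwards.\<close>

lemma (in linorder) ex1_rank:
  assumes "finite A" and "r < card A"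
  shows "\<exists>!t. t \<in> A \<and> card {x \<in> A. x < t} = r"
proof (rule ex_ex1I)
  show "\<exists>t. t \<in> A \<and> card {x \<in> A. x < t} = r"
    using assms
  proof (induction A rule: finite_linorder_max_induct)
    case empty
    then show ?case by simp
  next
    case (insert b A)
    have b: "b \<notin> A" using insert.hyps by auto
    show ?case
    proof (cases "r < card A")
      case True
      then obtain t where t: "t \<in> A" "card {x \<in> A. x < t} = r"
        using insert.IH by blast
      have "{x \<in> insert b A. x < t} = {x \<in> A. x < t}"
        using insert.hyps t(1) by force
      then show ?thesis using t by auto
    next
      case False
      then have "r = card A" using insert.prems insert.hyps b by simp
      moreover have "{x \<in> insert b A. x < b} = A"
        using insert.hyps by auto
      ultimately show ?thesis by (intro exI[of _ b]) simp
    qed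
  qed
next
  have less: "card {x \<in> A. x < t} < card {x \<in> A. x < u}" if "t \<in> A" "t < u" for t u
  proof (rule psubset_card_mono)
    show "finite {x \<in> A. x < u}" using \<open>finite A\<close> by simp
    show "{x \<in> A. x < t} \<subset> {x \<in> A. x < u}" using that by auto
  qed
  fix t u
  assume "t \<in> A \<and> card {x \<in> A. x < t} = r" "u \<in> A \<and> card {x \<in> A. x < u} = r"
  then show "t = u"
    using less[of t u] less[of u t] by (cases t u rule: linorder_cases) auto
qed

lemma assign_spec:
  assumes "asymp R" and "\<And>x. \<not> Q x x" and "sorted_wrt R bs" and "finite U" and "card U = length bs"
    and "\<And>b. b \<in> set bs \<Longrightarrow> card {j \<in> set bs. R j b} + r b < card {t \<in> U. P b t}"
    and choice: "\<And>b V. finite V \<Longrightarrow> r b < card {t \<in> V. P b t} \<Longrightarrow>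
       ch b V \<in> V \<and> P b (ch b V) \<and> card {x \<in> V. P b x \<and> Q x (ch b V)} = r b"
  shows "bij_betw (assign ch bs U s) (set bs) U
    \<and> (\<forall>x. x \<notin> set bs \<longrightarrow> assign ch bs U s x = s x)
    \<and> (\<forall>b\<in>set bs. P b (assign ch bs U s b) \<and>
         card {j \<in> set bs. R b j \<and> P b (assign ch bs U s j) \<and>
                 Q (assign ch bs U s j) (assign ch bs U s b)} = r b)"
  using assms(3-6)
proof (induction bs arbitrary: U s)
  case Nil
  then show ?case by (simp add: bij_betw_def)
next
  case (Cons b bs)
  define t where "t = ch b U"
  define f where "f = assign ch bs (U - {t}) (s(b := t))"
  have asym: "\<not> (R x y \<and> R y x)" for x y
    using \<open>asymp R\<close> by (meson asympD)
  have R: "R b j" "\<not> R j b" if "j \<in> set bs" for j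
    using that Cons.prems(1) asym[of b j] by auto
  have nR: "\<not> R b b" using asym[of b b] by blast
  have b: "b \<notin> set bs" using R(1)[of b] nR by blast
  have "r b < card {x \<in> U. P b x}"
    using Cons.prems(4)[of b] by simp
  then have t: "t \<in> U" "P b t" "card {x \<in> U. P b x \<and> Q x t} = r b"
    using choice[OF Cons.prems(2), of b] by (auto simp: t_def)
  \<comment> \<open>Removing \<open>t\<close> costs \<open>c\<close> at most one admissible value,
    and \<open>c\<close> has lost the predecessor \<open>b\<close> in exchange.\<close>
  have feasible: "card {j \<in> set bs. R j c} + r c < card {u \<in> U - {t}. P c u}"
    if c: "c \<in> set bs" for c
  proof -
    have "{j \<in> set (b # bs). R j c} = insert b {j \<in> set bs. R j c}"
      using R(1)[OF c] by auto
    then have "Suc (card {j \<in> set bs. R j c}) + r c < card {u \<in> U. P c u}"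
      using Cons.prems(4)[of c] c b by simp
    moreover have "{u \<in> U - {t}. P c u} = {u \<in> U. P c u} - {t}" by auto
    moreover have "card {u \<in> U. P c u} \<le> Suc (card ({u \<in> U. P c u} - {t}))"
      using diff_card_le_card_Diff[of "{t}" "{u \<in> U. P c u}"] by simp
    ultimately show ?thesis by simp
  qed
  have IH: "bij_betw f (set bs) (U - {t}) \<and> (\<forall>x. x \<notin> set bs \<longrightarrow> f x = (s(b := t)) x)
    \<and> (\<forall>c\<in>set bs. P c (f c) \<and> card {j \<in> set bs. R c j \<and> P c (f j) \<and> Q (f j) (f c)} = r c)"
    unfolding f_def
    by (rule Cons.IH) (use Cons.prems t(1) feasible in \<open>auto simp: card_Diff_singleton_if\<close>)
  have fb: "f b = t" using IH b by simp
  have bij: "bij_betw f (set (b # bs)) U"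
  proof -
    have "bij_betw f (insert b (set bs)) (insert (f b) (U - {t}))"
      using notIn_Un_bij_betw[of b "set bs" f "U - {t}"] IH b fb by simp
    then show ?thesis using fb t(1) by (simp add: insert_absorb)
  qed
  have card_b: "card {j \<in> set (b # bs). R b j \<and> P b (f j) \<and> Q (f j) (f b)} = r b"
  proof -
    have "inj_on f (set bs)" and im: "f ` set bs = U - {t}"
      using IH by (auto simp: bij_betw_def)
    \<comment> \<open>The later arguments are mapped bijectively onto \<open>U - {t}\<close>, and
      \<open>t\<close> itself is not counted because \<open>Q\<close> is irreflexive.\<close>
    have "{j \<in> set (b # bs). R b j \<and> P b (f j) \<and> Q (f j) (f b)} = {j \<in> set bs. P b (f j) \<and> Q (f j) t}"
      using R(1) nR fb by auto
    moreover have "card \<dots> = card (f ` {j \<in> set bs. P b (f j) \<and> Q (f j) t})"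
      by (rule card_image[symmetric]) (rule inj_on_subset[OF \<open>inj_on f (set bs)\<close>], auto)
    moreover have "f ` {j \<in> set bs. P b (f j) \<and> Q (f j) t} = {x \<in> f ` set bs. P b x \<and> Q x t}"
      by auto
    moreover have "\<dots> = {x \<in> U. P b x \<and> Q x t}"
      unfolding im using assms(2) by auto
    ultimately show ?thesis using t(3) by simp
  qed
  have card_c: "card {j \<in> set (b # bs). R c j \<and> P c (f j) \<and> Q (f j) (f c)} = r c"
    if c: "c \<in> set bs" for c
  proof -
    have "{j \<in> set (b # bs). R c j \<and> P c (f j) \<and> Q (f j) (f c)}
        = {j \<in> set bs. R c j \<and> P c (f j) \<and> Q (f j) (f c)}"
      using R(2)[OF c] by auto
    then show ?thesis using IH c by simp
  qed
  have "assign ch (b # bs) U s = f" by (simp add: f_def t_def Let_def)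
  moreover have "P c (f c)" if "c \<in> set (b # bs)" for c
    using that IH t(2) fb by auto
  moreover have "f x = s x" if "x \<notin> set (b # bs)" for x
    using that IH by simp
  ultimately show ?case using bij card_b card_c by auto
qed

lemma choose_F:
  assumes "finite V" and "rembr n p b < card {t \<in> V. b \<le> t}"
  shows "choose_F n p b V \<in> V \<and> b \<le> choose_F n p b V \<and>
    card {x \<in> V. b \<le> x \<and> x < choose_F n p b V} = rembr n p b"
proof -
  have "\<exists>!t. t \<in> {t \<in> V. b \<le> t} \<and> card {x \<in> {t \<in> V. b \<le> t}. x < t} = rembr n p b"
    using assms by (intro ex1_rank) auto
  then have "\<exists>!t. t \<in> V \<and> b \<le> t \<and> card {x \<in> V. b \<le> x \<and> x < t} = rembr n p b"
    by (simp add: conj_assoc)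
  from theI'[OF this] show ?thesis unfolding choose_F_def .
qed

lemma choose_G:
  assumes "finite V" and "rembr n p b < card {t \<in> V. t < b}"
  shows "choose_G n p b V \<in> V \<and> choose_G n p b V < b \<and>
    card {x \<in> V. x < b \<and> choose_G n p b V < x} = rembr n p b"
proof -
  have "\<exists>!t. t \<in> {t \<in> V. t < b} \<and> card {x \<in> {t \<in> V. t < b}. t < x} = rembr n p b"
    using assms by (intro linorder.ex1_rank[OF dual_linorder]) auto
  moreover have "{x \<in> {t \<in> V. t < b}. t < x} = {x \<in> V. t < x \<and> x < b}" for t
    by auto
  ultimately have "\<exists>!t. t \<in> V \<and> t < b \<and> card {x \<in> V. t < x \<and> x < b} = rembr n p b"
    by (simp add: conj_assoc)
  from theI'[OF this] show ?thesis unfolding choose_G_def by (simp add: conj_commute)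
qed

section \<open>Counting pairs\<close>

lemma card_filter_split:
  assumes "finite A"
  shows "card A = card {x \<in> A. P x} + card {x \<in> A. \<not> P x}"
proof -
  have "card ({x \<in> A. P x} \<union> {x \<in> A. \<not> P x}) = card {x \<in> A. P x} + card {x \<in> A. \<not> P x}"
    using assms by (intro card_Un_disjoint) auto
  moreover have "{x \<in> A. P x} \<union> {x \<in> A. \<not> P x} = A" by auto
  ultimately show ?thesis by simp
qed

lemma card_Un3_disjoint:
  assumes "finite A" "finite B" "finite C" and "A \<inter> B = {}" "A \<inter> C = {}" "B \<inter> C = {}"
  shows "card (A \<union> B \<union> C) = card A + card B + card C"
  using assms by (simp add: card_Un_disjoint Int_Un_distrib2)

lemma sum_card_swap:
  assumes "finite A" and "finite B"
  shows "(\<Sum>i\<in>A. card {j \<in> B. R i j}) = (\<Sum>j\<in>B. card {i \<in> A. R i j})"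
  using sum.swap_restrict[OF assms, of "\<lambda>_ _. 1 :: nat" R] by (simp add: conj_commute)

lemma card_less_pairs:
  fixes A :: "'a :: linorder set"
  assumes "finite A"
  shows "(\<Sum>y\<in>A. card {x \<in> A. x < y}) = card A choose 2"
  using assms
proof (induction A rule: finite_linorder_max_induct)
  case empty
  then show ?case by (simp add: numeral_2_eq_2)
next
  case (insert b A)
  have "b \<notin> A" using insert.hyps by auto
  moreover have "{x \<in> insert b A. x < b} = A" using insert.hyps by auto
  moreover have "{x \<in> insert b A. x < y} = {x \<in> A. x < y}" if "y \<in> A" for y
    using insert.hyps that by force
  ultimately show ?case
    using insert.hyps insert.IH by (simp add: numeral_2_eq_2)
qed

text \<open>Source of the binomial coefficient: a pair inside \<open>A\<close> is counted exactly
  once, at its larger element in the first form and at its smaller one in the second.\<close>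

lemma sum_card_outside:
  fixes A X :: "'a :: linorder set"
  assumes "finite X" and "A \<subseteq> X"
  shows "(\<Sum>y\<in>A. card {x \<in> X. x < y}) = (\<Sum>y\<in>A. card {x \<in> X - A. x < y}) + (card A choose 2)"
    and "(\<Sum>y\<in>A. card {x \<in> X. y < x}) = (\<Sum>y\<in>A. card {x \<in> X - A. y < x}) + (card A choose 2)"
proof -
  have A: "finite A" using assms finite_subset by blast
  have split: "card {x \<in> X. P x} = card {x \<in> X - A. P x} + card {x \<in> A. P x}" for P
    using assms A by (subst card_Un_disjoint[symmetric]) (auto intro: arg_cong[where f = card])
  show "(\<Sum>y\<in>A. card {x \<in> X. x < y}) = (\<Sum>y\<in>A. card {x \<in> X - A. x < y}) + (card A choose 2)"
    unfolding split sum.distrib card_less_pairs[OF A] ..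
  show "(\<Sum>y\<in>A. card {x \<in> X. y < x}) = (\<Sum>y\<in>A. card {x \<in> X - A. y < x}) + (card A choose 2)"
    unfolding split sum.distrib sum_card_swap[OF A A, of "(<)"] card_less_pairs[OF A] ..
qed

text \<open>Used for pattern occurrences: adjacency makes one of the three positions redundant,
  leaving pairs of a descent and a further position.\<close>

lemma card_eq_sum_sections:
  assumes "finite A" and "\<And>x. x \<in> A \<Longrightarrow> finite (B x)"
    and "bij_betw f S (SIGMA x:A. B x)"
  shows "card S = (\<Sum>x\<in>A. card (B x))"
  using bij_betw_same_card[OF assms(3)] card_SigmaI[of A B] assms(1,2) by simp

section \<open>The map on a fixed permutation\<close>

text \<open>The left counterpart of \<open>rembr\<close>. It will count alignments where
  \<open>rembr\<close> counts crossings.\<close>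

definition lembr :: "nat \<Rightarrow> (nat \<Rightarrow> nat) \<Rightarrow> nat \<Rightarrow> nat" where
  "lembr n p l = card {i \<in> descents n p. i + 1 < inv p l \<and> p (i + 1) < l \<and> l < p i}"

context
  fixes n :: nat and p :: "nat \<Rightarrow> nat"
  assumes n: "1 \<le> n" and p: "p permutes {1..n}"
begin

abbreviation (input) "D \<equiv> descents n p"
abbreviation (input) "F \<equiv> F_set n p"
abbreviation (input) "F' \<equiv> F'_set n p"
abbreviation (input) "G \<equiv> G_set n p"
abbreviation (input) "G' \<equiv> G'_set n p"
abbreviation (input) "s \<equiv> Psi n p"

section \<open>Descents and the four sets of arguments and values\<close>

lemma inj_p: "inj_on p A"
  using permutes_inj_on[OF p] .

lemma p_eq_iff [simp]: "p i = p j \<longleftrightarrow> i = j"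
  using permutes_inj[OF p] by (simp add: inj_eq)

lemma inv_p [simp]: "inv p (p i) = i"
  using permutes_inverses(2)[OF p] .

lemma p_range [simp]: "p i \<in> {1..n} \<longleftrightarrow> i \<in> {1..n}"
  using permutes_in_image[OF p] .

lemma p_bounds: "1 \<le> i \<Longrightarrow> i \<le> n \<Longrightarrow> 1 \<le> p i \<and> p i \<le> n"
  using p_range[of i] by (simp del: p_range)

lemma descent_bounds:
  assumes "i \<in> D"
  shows "1 \<le> i" "i < n" "1 \<le> p (i + 1)" "p (i + 1) < p i" "p i \<le> n"
  using assms p_bounds[of i] p_bounds[of "i + 1"] by (auto simp: descents_def)

lemma finite_D [simp]: "finite D"
  by (rule finite_subset[of _ "{1..n}"]) (auto simp: descents_def)

lemma tops_eq: "descent_tops n p = p ` D"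
  by (auto simp: descent_tops_def)

lemma bottoms_eq: "descent_bottoms n p = (\<lambda>i. p (i + 1)) ` D"
  by (auto simp: descent_bottoms_def)

lemma F_eq: "F = insert 1 ((\<lambda>i. p (i + 1) + 1) ` D)"
  by (auto simp: F_set_def bottoms_eq)

lemma F'_eq: "F' = insert n ((\<lambda>i. p i - 1) ` D)"
  by (auto simp: F'_set_def tops_eq)

lemma F_subset: "F \<subseteq> {1..n}"
proof -
  have "p (i + 1) + 1 \<le> n" if "i \<in> D" for i
    using descent_bounds(4,5)[OF that] by linarith
  then show ?thesis using n by (auto simp: F_eq)
qed

lemma F'_subset: "F' \<subseteq> {1..n}"
proof -
  have "1 \<le> p i - 1 \<and> p i - 1 \<le> n" if "i \<in> D" for i
    using descent_bounds(3-5)[OF that] by linarith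
  then show ?thesis using n by (auto simp: F'_eq)
qed

lemma finite_F [simp]: "finite F" and finite_F' [simp]: "finite F'"
  by (simp_all add: F_eq F'_eq)

lemma G_eq: "G = {1..n} - F"
proof (intro equalityI subsetI)
  fix g assume "g \<in> G"
  then show "g \<in> {1..n} - F" by (auto simp: G_set_def F_set_def)
next
  fix g assume g: "g \<in> {1..n} - F"
  then have "g - 1 \<in> {1..n} - descent_bottoms n p - {n}" "g = g - 1 + 1"
    by (force simp: F_set_def)+
  then show "g \<in> G" unfolding G_set_def by (rule rev_image_eqI)
qed

lemma G'_eq: "G' = {1..n} - F'"
proof (intro equalityI subsetI)
  fix g assume "g \<in> G'"
  then obtain x where x: "g = x - 1" "x \<in> {1..n}" "x \<notin> descent_tops n p" "x \<noteq> 1"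
    unfolding G'_set_def by blast
  \<comment> \<open>Truncated subtraction would identify 0 and 1, so injectivity rests on letters
    being positive.\<close>
  moreover have "y - 1 \<noteq> x - 1" if "y \<in> descent_tops n p" for y
  proof -
    have "1 < y" using that descent_bounds(3,4) by (fastforce simp: tops_eq)
    moreover have "1 < x" using x by auto
    moreover have "x \<noteq> y" using x that by auto
    ultimately show ?thesis by linarith
  qed
  ultimately show "g \<in> {1..n} - F'"
    by (force simp: F'_set_def)
next
  fix g assume g: "g \<in> {1..n} - F'"
  then have "g + 1 \<in> {1..n} - descent_tops n p - {1}" "g = g + 1 - 1"
    by (force simp: F'_set_def)+
  then show "g \<in> G'" unfolding G'_set_def by (rule rev_image_eqI)
qed

lemma finite_G [simp]: "finite G" and finite_G' [simp]: "finite G'"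
  by (simp_all add: G_eq G'_eq)

section \<open>Counting below a bound in the four sets\<close>

lemma card_F: "card {j \<in> F. P j} = (if P 1 then 1 else 0) + card {i \<in> D. P (p (i + 1) + 1)}"
proof -
  have inj: "inj_on (\<lambda>i. p (i + 1) + 1) {i \<in> D. P (p (i + 1) + 1)}"
    by (auto simp: inj_on_def)
  \<comment> \<open>Bottoms are at least 1, so the adjoined 1 is a new element and is counted
    separately.\<close>
  have "1 \<notin> (\<lambda>i. p (i + 1) + 1) ` D"
    by (auto dest: descent_bounds(3))
  moreover have "{j \<in> F. P j}
      = (if P 1 then {1} else {}) \<union> (\<lambda>i. p (i + 1) + 1) ` {i \<in> D. P (p (i + 1) + 1)}"
    by (auto simp: F_eq)
  ultimately show ?thesis
    using card_image[OF inj] by (subst (1) \<open>{j \<in> F. P j} = _\<close>, subst card_Un_disjoint) auto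
qed

lemma inj_pred_top: "inj_on (\<lambda>i. p i - 1) D"
proof (rule inj_onI)
  fix i j assume "i \<in> D" "j \<in> D" "p i - 1 = p j - 1"
  then have "p i = p j"
    using descent_bounds(4)[of i] descent_bounds(4)[of j] by linarith
  then show "i = j" by simp
qed

lemma card_F': "card {t \<in> F'. P t} = (if P n then 1 else 0) + card {i \<in> D. P (p i - 1)}"
proof -
  have inj: "inj_on (\<lambda>i. p i - 1) {i \<in> D. P (p i - 1)}"
    by (rule inj_on_subset[OF inj_pred_top]) auto
  have "n \<noteq> p i - 1" if "i \<in> D" for i
    using descent_bounds(4,5)[OF that] by linarith
  then have "n \<notin> (\<lambda>i. p i - 1) ` D" by blast
  moreover have "{t \<in> F'. P t} = (if P n then {n} else {}) \<union> (\<lambda>i. p i - 1) ` {i \<in> D. P (p i - 1)}"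
    by (auto simp: F'_eq)
  ultimately show ?thesis
    using card_image[OF inj] by (subst (1) \<open>{t \<in> F'. P t} = _\<close>, subst card_Un_disjoint) auto
qed

lemma card_F_eq: "card F = card D + 1" and card_F'_eq: "card F' = card D + 1"
  using card_F[of "\<lambda>_. True"] card_F'[of "\<lambda>_. True"] by auto

lemma card_G_eq: "card G = card G'"
  using card_F_eq card_F'_eq F_subset F'_subset by (simp add: G_eq G'_eq card_Diff_subset)

text \<open>A descent with bottom below \<open>b\<close> either has its top at most \<open>b\<close>
  or embraces \<open>b\<close>. After the shifts by one, the bottoms below \<open>b\<close> are the
  elements of \<open>F\<close> up to \<open>b\<close> other than the adjoined 1, and the tops up to
  \<open>b\<close> are the elements of \<open>F'\<close> below \<open>b\<close>; the adjoined
  \<open>n\<close> is never below \<open>b\<close>.\<close>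

lemma balance_F:
  assumes "b \<in> {1..n}"
  shows "card {j \<in> F. j \<le> b} = 1 + (lembr n p b + rembr n p b) + card {t \<in> F'. t < b}"
proof -
  obtain k where k: "b = p k"
    using permutes_surj[OF p] by (metis surjD)
  have split: "{i \<in> D. p (i + 1) < b} = {i \<in> D. i + 1 < inv p b \<and> p (i + 1) < b \<and> b < p i}
      \<union> {i \<in> D. inv p b < i \<and> p (i + 1) < b \<and> b < p i} \<union> {i \<in> D. p i \<le> b}"
  proof (intro equalityI subsetI)
    fix i assume i: "i \<in> {i \<in> D. p (i + 1) < b}"
    then have neq: "k \<noteq> i + 1" by (auto simp: k)
    show "i \<in> {i \<in> D. i + 1 < inv p b \<and> p (i + 1) < b \<and> b < p i}
      \<union> {i \<in> D. inv p b < i \<and> p (i + 1) < b \<and> b < p i} \<union> {i \<in> D. p i \<le> b}"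
    proof (cases "p i \<le> b")
      case True
      then show ?thesis using i by simp
    next
      case False
      then have "k \<noteq> i" by (auto simp: k)
      \<comment> \<open>Neither letter of the descent is \<open>b\<close>, so the adjacent pair lies
        entirely on one side of position \<open>k\<close>.\<close>
      then have "i + 1 < k \<or> k < i" using neq by linarith
      then show ?thesis using False i by (simp add: k)
    qed
  next
    fix i assume "i \<in> {i \<in> D. i + 1 < inv p b \<and> p (i + 1) < b \<and> b < p i}
      \<union> {i \<in> D. inv p b < i \<and> p (i + 1) < b \<and> b < p i} \<union> {i \<in> D. p i \<le> b}"
    then show "i \<in> {i \<in> D. p (i + 1) < b}" by (auto dest: descent_bounds(4))
  qed
  have "card {i \<in> D. p (i + 1) < b} = lembr n p b + rembr n p b + card {i \<in> D. p i \<le> b}"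
    unfolding split lembr_def rembr_def by (rule card_Un3_disjoint) auto
  moreover have "{i \<in> D. p i \<le> b} = {i \<in> D. p i - 1 < b}"
  proof -
    have "p i \<le> b \<longleftrightarrow> p i - 1 < b" if "i \<in> D" for i
      using descent_bounds(4)[OF that] by linarith
    then show ?thesis by blast
  qed
  ultimately show ?thesis
    using assms card_F[of "\<lambda>j. j \<le> b"] card_F'[of "\<lambda>j. j < b"] by (simp add: Suc_le_eq)
qed

text \<open>Take complements in \<open>{1..b}\<close> and \<open>{1..<b}\<close>. Their sizes differ
  by one, which absorbs the 1 of \<open>balance_F\<close>, and the embracing number changes
  sides.\<close>

lemma balance_G:
  assumes "b \<in> {1..n}"
  shows "card {t \<in> G'. t < b} = card {j \<in> G. j \<le> b} + (lembr n p b + rembr n p b)"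
proof -
  have "{j \<in> G. j \<le> b} = {1..b} - {j \<in> F. j \<le> b}" "{t \<in> G'. t < b} = {1..<b} - {t \<in> F'. t < b}"
    using assms by (auto simp: G_eq G'_eq)
  moreover have "{j \<in> F. j \<le> b} \<subseteq> {1..b}" "{t \<in> F'. t < b} \<subseteq> {1..<b}"
    using F_subset F'_subset by auto
  ultimately have "card {j \<in> G. j \<le> b} = b - card {j \<in> F. j \<le> b} \<and> card {j \<in> F. j \<le> b} \<le> b"
    and "card {t \<in> G'. t < b} = b - 1 - card {t \<in> F'. t < b} \<and> card {t \<in> F'. t < b} \<le> b - 1"
    using card_mono[of "{1..b}" "{j \<in> F. j \<le> b}"] card_mono[of "{1..<b}" "{t \<in> F'. t < b}"]
    by (auto simp: card_Diff_subset)
  then show ?thesis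
    using balance_F[OF assms] assms by auto
qed

section \<open>The two greedy passes of \<open>Psi\<close>\<close>

lemma Psi_spec:
  shows bij_F: "bij_betw s F F'" and bij_G: "bij_betw s G G'"
    and F_ge: "\<And>i. i \<in> F \<Longrightarrow> i \<le> s i" and G_less: "\<And>i. i \<in> G \<Longrightarrow> s i < i"
    and crossings_F: "\<And>i. i \<in> F \<Longrightarrow> card {j \<in> F. j < i \<and> i \<le> s j \<and> s j < s i} = rembr n p i"
    and crossings_G: "\<And>i. i \<in> G \<Longrightarrow> card {j \<in> G. i < j \<and> s j < i \<and> s i < s j} = rembr n p i"
proof -
  define f where "f = assign (choose_F n p) (rev (sorted_list_of_set F)) F' id"
  have s: "s = assign (choose_G n p) (sorted_list_of_set G) G' f"
    by (simp add: Psi_def f_def)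
  \<comment> \<open>As \<open>F\<close> and \<open>F'\<close> have equal size,
    \<open>balance_F\<close> makes the right side larger than the left by exactly
    \<open>1 + lembr n p b\<close>.\<close>
  have feasible_F: "card {j \<in> F. b < j} + rembr n p b < card {t \<in> F'. b \<le> t}" if "b \<in> F" for b
  proof -
    have "card F = card {j \<in> F. j \<le> b} + card {j \<in> F. b < j}"
      using card_filter_split[OF finite_F, of "\<lambda>j. j \<le> b"] by (simp add: not_le)
    moreover have "card F' = card {t \<in> F'. t < b} + card {t \<in> F'. b \<le> t}"
      using card_filter_split[OF finite_F', of "\<lambda>t. t < b"] by (simp add: not_less)
    ultimately show ?thesis
      using balance_F[of b] that F_subset card_F_eq card_F'_eq by auto
  qed
  \<comment> \<open>Strictness comes from \<open>b\<close> itself, which \<open>balance_G\<close>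
    counts among the \<open>j \<le> b\<close>.\<close>
  have feasible_G: "card {j \<in> G. j < b} + rembr n p b < card {t \<in> G'. t < b}" if "b \<in> G" for b
  proof -
    have "{j \<in> G. j \<le> b} = insert b {j \<in> G. j < b}" using that by auto
    then have "card {j \<in> G. j \<le> b} = Suc (card {j \<in> G. j < b})" by simp
    then show ?thesis
      using balance_G[of b] that by (simp add: G_eq)
  qed
  \<comment> \<open>In decreasing order the later arguments are the smaller ones, so the rank counts
    the \<open>j < b\<close> of a crossing; in the increasing second pass it counts the
    \<open>j > b\<close>.\<close>
  have F: "bij_betw f F F' \<and> (\<forall>x. x \<notin> F \<longrightarrow> f x = x)
    \<and> (\<forall>b\<in>F. b \<le> f b \<and> card {j \<in> F. j < b \<and> b \<le> f j \<and> f j < f b} = rembr n p b)"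
    using assign_spec[where R = "(>)" and P = "(\<le>)" and Q = "(<)" and r = "rembr n p"
        and ch = "choose_F n p" and bs = "rev (sorted_list_of_set F)" and U = F' and s = id]
      feasible_F choose_F card_F_eq card_F'_eq
    by (simp add: sorted_wrt_rev f_def)
  have G: "bij_betw s G G' \<and> (\<forall>x. x \<notin> G \<longrightarrow> s x = f x)
    \<and> (\<forall>b\<in>G. s b < b \<and> card {j \<in> G. b < j \<and> s j < b \<and> s b < s j} = rembr n p b)"
    using assign_spec[where R = "(<)" and P = "(>)" and Q = "(>)" and r = "rembr n p"
        and ch = "choose_G n p" and bs = "sorted_list_of_set G" and U = G' and s = f]
      feasible_G choose_G card_G_eq
    by (simp add: s)
  \<comment> \<open>The second pass only writes at arguments in \<open>G\<close>, which is disjoint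
    from \<open>F\<close>.\<close>
  have sF: "s x = f x" if "x \<in> F" for x
    using G that by (auto simp: G_eq)
  show "bij_betw s F F'"
    using F bij_betw_cong[of F s f F'] sF by simp
  show "bij_betw s G G'" using G by simp
  show "i \<le> s i" if "i \<in> F" for i using F sF that by simp
  show "s i < i" if "i \<in> G" for i using G that by simp
  show "card {j \<in> F. j < i \<and> i \<le> s j \<and> s j < s i} = rembr n p i" if "i \<in> F" for i
  proof -
    have "{j \<in> F. j < i \<and> i \<le> s j \<and> s j < s i} = {j \<in> F. j < i \<and> i \<le> f j \<and> f j < f i}"
      using sF that by auto
    then show ?thesis using F that by simp
  qed
  show "card {j \<in> G. i < j \<and> s j < i \<and> s i < s j} = rembr n p i" if "i \<in> G" for i
    using G that by simp
qed

section \<open>Weak excedances, crossings and alignments of equal type\<close>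

lemma F_iff: "i \<in> F \<longleftrightarrow> i \<in> {1..n} \<and> i \<le> s i"
  using F_subset F_ge[of i] G_less[of i] unfolding G_eq
  by (metis DiffI leD subsetD)

lemma G_iff: "i \<in> G \<longleftrightarrow> i \<in> {1..n} \<and> s i < i"
  using F_iff[of i] by (auto simp: G_eq)

lemma card_vimage_F: "card {j \<in> F. P (s j)} = card {t \<in> F'. P t}"
proof (rule bij_betw_same_card)
  show "bij_betw s {j \<in> F. P (s j)} {t \<in> F'. P t}"
    using bij_F by (auto simp: bij_betw_def inj_on_def)
qed

lemma card_vimage_G: "card {j \<in> G. P (s j)} = card {t \<in> G'. P t}"
proof (rule bij_betw_same_card)
  show "bij_betw s {j \<in> G. P (s j)} {t \<in> G'. P t}"
    using bij_G by (auto simp: bij_betw_def inj_on_def)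
qed

text \<open>Sort the \<open>j \<le> i\<close> in \<open>F\<close> by value: \<open>i\<close> itself,
  those with \<open>s j < i\<close>, the crossings and the alignments. The second group has as many
  members as \<open>F'\<close> has elements below \<open>i\<close>, so \<open>balance_F\<close>
  leaves the embracing number for the last two.\<close>

lemma crossings_alignments_F:
  assumes i: "i \<in> F"
  shows "card {j \<in> F. j < i \<and> i \<le> s j \<and> s j < s i} + card {j \<in> F. j < i \<and> s i < s j}
    = lembr n p i + rembr n p i"
proof -
  have split: "{j \<in> F. j \<le> i} = insert i ({j \<in> F. s j < i}
    \<union> {j \<in> F. j < i \<and> i \<le> s j \<and> s j < s i} \<union> {j \<in> F. j < i \<and> s i < s j})" (is "_ = insert i ?U")
  proof (intro equalityI subsetI)
    fix j assume j: "j \<in> {j \<in> F. j \<le> i}"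
    then have "s j = s i \<longrightarrow> j = i"
      using i bij_F by (auto simp: bij_betw_def inj_on_def)
    then consider "j = i" | "j < i" "s j < s i" | "j < i" "s i < s j"
      using j by fastforce
    then show "j \<in> insert i ?U"
      using j by cases auto
  next
    fix j assume "j \<in> insert i ?U"
    then show "j \<in> {j \<in> F. j \<le> i}"
      using i F_ge[of j] by auto
  qed
  have "i \<notin> ?U" using F_ge[OF i] by simp
  then have "card {j \<in> F. j \<le> i} = 1 + card ?U"
    unfolding split by simp
  moreover have "card ?U = card {j \<in> F. s j < i} + card {j \<in> F. j < i \<and> i \<le> s j \<and> s j < s i}
      + card {j \<in> F. j < i \<and> s i < s j}"
    using F_ge[OF i] by (intro card_Un3_disjoint) auto
  ultimately show ?thesis
    using balance_F[of i] card_vimage_F[of "\<lambda>t. t < i"] i F_subset by auto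
qed

text \<open>Here the \<open>j\<close> in \<open>G\<close> with \<open>s j < i\<close> are sorted by
  argument: every \<open>j \<le> i\<close> qualifies because \<open>s j < j\<close>, and those
  beyond \<open>i\<close> are crossings or alignments. Conclude by \<open>balance_G\<close>.\<close>

lemma crossings_alignments_G:
  assumes i: "i \<in> G"
  shows "card {j \<in> G. i < j \<and> s j < i \<and> s i < s j} + card {j \<in> G. i < j \<and> s j < s i}
    = lembr n p i + rembr n p i"
proof -
  have split: "{j \<in> G. s j < i} = {j \<in> G. j \<le> i}
    \<union> {j \<in> G. i < j \<and> s j < i \<and> s i < s j} \<union> {j \<in> G. i < j \<and> s j < s i}" (is "_ = ?U")
  proof (intro equalityI subsetI)
    fix j assume j: "j \<in> {j \<in> G. s j < i}"
    then have "s j = s i \<longrightarrow> j = i"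
      using i bij_G by (auto simp: bij_betw_def inj_on_def)
    then consider "j \<le> i" | "i < j" "s i < s j" | "i < j" "s j < s i"
      by fastforce
    then show "j \<in> ?U"
      using j by cases auto
  next
    fix j assume "j \<in> ?U"
    then show "j \<in> {j \<in> G. s j < i}"
      using G_less[OF i] G_less[of j] by auto
  qed
  have "card {j \<in> G. s j < i} = card {j \<in> G. j \<le> i}
    + card {j \<in> G. i < j \<and> s j < i \<and> s i < s j} + card {j \<in> G. i < j \<and> s j < s i}"
    unfolding split by (intro card_Un3_disjoint) auto
  then show ?thesis
    using balance_G[of i] card_vimage_G[of "\<lambda>t. t < i"] i by (auto simp: G_eq)
qed

text \<open>The type of \<open>i\<close> empties the sets of the other type, and in the remaining
  ones the inequalities force \<open>j\<close> to have the same type as \<open>i\<close>.\<close>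

lemma crossings_alignments:
  assumes i: "i \<in> {1..n}"
  shows "card {j \<in> {1..n}. j < i \<and> i \<le> s j \<and> s j < s i}
      + card {j \<in> {1..n}. s i < s j \<and> s j < i \<and> i < j} = rembr n p i" (is "?CE + ?CN = _")
    and "card {j \<in> {1..n}. j < i \<and> i \<le> s i \<and> s i < s j}
      + card {j \<in> {1..n}. s j < s i \<and> s i < i \<and> i < j} = lembr n p i" (is "?AE + ?AN = _")
proof -
  consider "i \<in> F" | "i \<in> G" using i by (auto simp: G_eq)
  then have "?CE + ?CN = rembr n p i \<and> ?AE + ?AN = lembr n p i"
  proof cases
    case 1
    have "{j \<in> {1..n}. j < i \<and> i \<le> s j \<and> s j < s i} = {j \<in> F. j < i \<and> i \<le> s j \<and> s j < s i}"
      "{j \<in> {1..n}. s i < s j \<and> s j < i \<and> i < j} = {}"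
      "{j \<in> {1..n}. j < i \<and> i \<le> s i \<and> s i < s j} = {j \<in> F. j < i \<and> s i < s j}"
      "{j \<in> {1..n}. s j < s i \<and> s i < i \<and> i < j} = {}"
      using F_ge[OF 1] by (auto simp: F_iff)
    then show ?thesis
      using crossings_F[OF 1] crossings_alignments_F[OF 1] by simp
  next
    case 2
    have "{j \<in> {1..n}. j < i \<and> i \<le> s j \<and> s j < s i} = {}"
      "{j \<in> {1..n}. s i < s j \<and> s j < i \<and> i < j} = {j \<in> G. i < j \<and> s j < i \<and> s i < s j}"
      "{j \<in> {1..n}. j < i \<and> i \<le> s i \<and> s i < s j} = {}"
      "{j \<in> {1..n}. s j < s i \<and> s i < i \<and> i < j} = {j \<in> G. i < j \<and> s j < s i}"
      using G_less[OF 2] by (auto simp: G_iff)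
    then show ?thesis
      using crossings_G[OF 2] crossings_alignments_G[OF 2] by simp
  qed
  then show "?CE + ?CN = rembr n p i" "?AE + ?AN = lembr n p i" by auto
qed

lemma C_eq_sum: "C_EE n s + C_NN n s = (\<Sum>i=1..n. rembr n p i)"
  unfolding C_EE_def C_NN_def sum.distrib[symmetric]
  by (rule sum.cong[OF refl]) (rule crossings_alignments(1))

lemma A_eq_sum: "A_EE n s + A_NN n s = (\<Sum>i=1..n. lembr n p i)"
  unfolding A_EE_def A_NN_def sum.distrib[symmetric]
  by (rule sum.cong[OF refl]) (rule crossings_alignments(2))

lemma wex_eq: "wex n s = des n p + 1"
proof -
  have "{i \<in> {1..n}. i \<le> s i} = F" using F_iff by auto
  then show ?thesis by (simp add: wex_def des_def card_F_eq)
qed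

section \<open>Alignments of mixed type\<close>

lemma A_EN_eq: "A_EN n s = (\<Sum>i\<in>D. card {v \<in> {1..n} - descent_tops n p. p i < v})"
proof -
  have "A_EN n s = (\<Sum>i\<in>{1..n}. card {j \<in> F. s j < s i \<and> s i < i})"
    unfolding A_EN_def by (intro sum.cong refl arg_cong[where f = card]) (auto simp: F_iff)
  also have "\<dots> = (\<Sum>j\<in>F. card {i \<in> {1..n}. s j < s i \<and> s i < i})"
    by (rule sum_card_swap) simp_all
  also have "\<dots> = (\<Sum>j\<in>F. card {i \<in> G. s j < s i})"
    by (intro sum.cong refl arg_cong[where f = card]) (auto simp: G_iff)
  \<comment> \<open>Once the types are fixed, only values are compared, so both variables can be
    moved along \<open>s\<close> to the value sets.\<close>
  also have "\<dots> = (\<Sum>j\<in>F. card {u \<in> G'. s j < u})"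
    by (simp only: card_vimage_G)
  also have "\<dots> = (\<Sum>t\<in>F'. card {u \<in> G'. t < u})"
    by (rule sum.reindex_bij_betw[OF bij_F])
  \<comment> \<open>The adjoined value \<open>n\<close> contributes 0, as nothing in
    \<open>G'\<close> exceeds it.\<close>
  also have "\<dots> = (\<Sum>t\<in>(\<lambda>i. p i - 1) ` D. card {u \<in> G'. t < u})"
  proof (rule sum.mono_neutral_right)
    show "\<forall>t\<in>F' - (\<lambda>i. p i - 1) ` D. card {u \<in> G'. t < u} = 0"
      by (auto simp: F'_eq G'_eq)
  qed (auto simp: F'_eq)
  also have "\<dots> = (\<Sum>i\<in>D. card {u \<in> G'. p i - 1 < u})"
    by (rule sum.reindex_cong[OF inj_pred_top]) simp_all
  also have "\<dots> = (\<Sum>i\<in>D. card {v \<in> {1..n} - descent_tops n p. p i < v})"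
  proof (rule sum.cong[OF refl])
    fix i assume i: "i \<in> D"
    \<comment> \<open>The letter 1 removed in forming \<open>G'\<close> cannot exceed a descent
      top.\<close>
    have "{u \<in> G'. p i - 1 < u} = (\<lambda>v. v - 1) ` {v \<in> {1..n} - descent_tops n p. p i < v}"
      using descent_bounds[OF i] by (force simp: G'_set_def)
    moreover have "inj_on (\<lambda>v. v - 1) {v \<in> {1..n} - descent_tops n p. p i < v}"
      by (rule inj_onI) force
    ultimately show "card {u \<in> G'. p i - 1 < u} = card {v \<in> {1..n} - descent_tops n p. p i < v}"
      by (simp add: card_image)
  qed
  finally show ?thesis .
qed

text \<open>Once the types are fixed, only arguments are compared, so the count is over
  \<open>F\<close> and \<open>G\<close> directly. The adjoined argument 1 contributes 0, and the
  letter \<open>n\<close> removed in forming \<open>G\<close> is not below any bottom.\<close>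

lemma A_NE_eq: "A_NE n s = (\<Sum>i\<in>D. card {v \<in> {1..n} - descent_bottoms n p. v < p (i + 1)})"
proof -
  have "A_NE n s = (\<Sum>i\<in>{1..n}. card {j \<in> F. s i < i \<and> i < j})"
    unfolding A_NE_def by (intro sum.cong refl arg_cong[where f = card]) (auto simp: F_iff)
  also have "\<dots> = (\<Sum>j\<in>F. card {i \<in> {1..n}. s i < i \<and> i < j})"
    by (rule sum_card_swap) simp_all
  also have "\<dots> = (\<Sum>j\<in>F. card {i \<in> G. i < j})"
    by (intro sum.cong refl arg_cong[where f = card]) (auto simp: G_iff)
  also have "\<dots> = (\<Sum>j\<in>(\<lambda>i. p (i + 1) + 1) ` D. card {i \<in> G. i < j})"
  proof (rule sum.mono_neutral_right)
    show "\<forall>j\<in>F - (\<lambda>i. p (i + 1) + 1) ` D. card {i \<in> G. i < j} = 0"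
      by (auto simp: F_eq G_eq)
  qed (auto simp: F_eq)
  also have "\<dots> = (\<Sum>i\<in>D. card {g \<in> G. g < p (i + 1) + 1})"
    by (rule sum.reindex_cong[of "\<lambda>i. p (i + 1) + 1"]) (auto simp: inj_on_def)
  also have "\<dots> = (\<Sum>i\<in>D. card {v \<in> {1..n} - descent_bottoms n p. v < p (i + 1)})"
  proof (rule sum.cong[OF refl])
    fix i assume i: "i \<in> D"
    have "{g \<in> G. g < p (i + 1) + 1} = (\<lambda>v. v + 1) ` {v \<in> {1..n} - descent_bottoms n p. v < p (i + 1)}"
      using descent_bounds[OF i] by (force simp: G_set_def)
    then show "card {g \<in> G. g < p (i + 1) + 1} = card {v \<in> {1..n} - descent_bottoms n p. v < p (i + 1)}"
      by (simp add: card_image)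
  qed
  finally show ?thesis .
qed

section \<open>Pattern occurrences as sums over descents\<close>

lemma card_positions: "card {k \<in> {1..n}. P (p k)} = card {v \<in> {1..n}. P v}"
proof -
  have "{v \<in> {1..n}. P v} = {v \<in> p ` {1..n}. P v}"
    by (simp only: permutes_image[OF p])
  also have "\<dots> = p ` {k \<in> {1..n}. P (p k)}" by blast
  finally show ?thesis using card_image[OF inj_p] by simp
qed

lemma not_less_p: "\<not> p i < p k \<longleftrightarrow> k = i \<or> p k < p i"
  using p_eq_iff[of k i] by (auto simp: not_less le_less)

lemma descents_iff: "i \<in> D \<longleftrightarrow> 1 \<le> i \<and> i < n \<and> \<not> p i < p (i + 1)"
  using not_less_p[of i "i + 1"] by (auto simp: descents_def)

text \<open>With \<open>b < a\<close> the adjacent pair is a descent, so an occurrence is a descent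
  and a position to its right. The comparisons with the third letter stay as equivalences, to be
  evaluated for each pattern.\<close>

lemma occurrences_Adj_Dash:
  assumes "b < a"
  shows "occurrences n a Adj b Dash c p
    = (\<Sum>i\<in>D. card {k \<in> {1..n}. i + 1 < k \<and> (p i < p k \<longleftrightarrow> a < c) \<and> (p (i + 1) < p k \<longleftrightarrow> b < c)})"
  unfolding occurrences_def
proof (rule card_eq_sum_sections)
  show "bij_betw (\<lambda>(i, j, k). (i, k)) {(i, j, k). 1 \<le> i \<and> i < j \<and> j < k \<and> k \<le> n \<and>
       (Adj = Adj \<longrightarrow> j = i + 1) \<and> (Dash = Adj \<longrightarrow> k = j + 1) \<and>
       (p i < p j \<longleftrightarrow> a < b) \<and> (p i < p k \<longleftrightarrow> a < c) \<and> (p j < p k \<longleftrightarrow> b < c)}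
     (SIGMA i:D. {k \<in> {1..n}. i + 1 < k \<and> (p i < p k \<longleftrightarrow> a < c) \<and> (p (i + 1) < p k \<longleftrightarrow> b < c)})"
    by (rule bij_betw_byWitness[where f' = "\<lambda>(i, k). (i, i + 1, k)"])
       (use assms in \<open>auto simp: descents_iff\<close>)
qed simp_all

lemma occurrences_Dash_Adj:
  assumes "c < b"
  shows "occurrences n a Dash b Adj c p
    = (\<Sum>i\<in>D. card {k \<in> {1..n}. k < i \<and> (p k < p i \<longleftrightarrow> a < b) \<and> (p k < p (i + 1) \<longleftrightarrow> a < c)})"
  unfolding occurrences_def
proof (rule card_eq_sum_sections)
  show "bij_betw (\<lambda>(i, j, k). (j, i)) {(i, j, k). 1 \<le> i \<and> i < j \<and> j < k \<and> k \<le> n \<and>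
       (Dash = Adj \<longrightarrow> j = i + 1) \<and> (Adj = Adj \<longrightarrow> k = j + 1) \<and>
       (p i < p j \<longleftrightarrow> a < b) \<and> (p i < p k \<longleftrightarrow> a < c) \<and> (p j < p k \<longleftrightarrow> b < c)}
     (SIGMA i:D. {k \<in> {1..n}. k < i \<and> (p k < p i \<longleftrightarrow> a < b) \<and> (p k < p (i + 1) \<longleftrightarrow> a < c)})"
    by (rule bij_betw_byWitness[where f' = "\<lambda>(i, k). (k, i, i + 1)"])
       (use assms in \<open>auto simp: descents_iff\<close>)
qed simp_all

text \<open>Double counting: grouped by the letter playing 2, the occurrences are the descents to
  its left that embrace it.\<close>

lemma occurrences_31_2: "occurrences n 3 Adj 1 Dash 2 p = (\<Sum>l=1..n. lembr n p l)"
proof -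
  have "occurrences n 3 Adj 1 Dash 2 p
      = (\<Sum>i\<in>D. card {k \<in> {1..n}. i + 1 < k \<and> p (i + 1) < p k \<and> p k < p i})"
    by (subst occurrences_Adj_Dash) (auto simp: not_less_p intro!: sum.cong arg_cong[where f = card])
  also have "\<dots> = (\<Sum>k\<in>{1..n}. card {i \<in> D. i + 1 < k \<and> p (i + 1) < p k \<and> p k < p i})"
    by (rule sum_card_swap) simp_all
  also have "\<dots> = (\<Sum>k\<in>{1..n}. lembr n p (p k))" by (simp add: lembr_def)
  also have "\<dots> = (\<Sum>l\<in>{1..n}. lembr n p l)"
    by (rule sum.reindex_bij_betw[OF permutes_imp_bij[OF p]])
  finally show ?thesis .
qed

lemma occurrences_2_31: "occurrences n 2 Dash 3 Adj 1 p = (\<Sum>l=1..n. rembr n p l)"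
proof -
  have "occurrences n 2 Dash 3 Adj 1 p
      = (\<Sum>i\<in>D. card {k \<in> {1..n}. k < i \<and> p (i + 1) < p k \<and> p k < p i})"
    by (subst occurrences_Dash_Adj) (auto simp: not_less_p intro!: sum.cong arg_cong[where f = card])
  also have "\<dots> = (\<Sum>k\<in>{1..n}. card {i \<in> D. k < i \<and> p (i + 1) < p k \<and> p k < p i})"
    by (rule sum_card_swap) simp_all
  also have "\<dots> = (\<Sum>k\<in>{1..n}. rembr n p (p k))" by (simp add: rembr_def)
  also have "\<dots> = (\<Sum>l\<in>{1..n}. rembr n p l)"
    by (rule sum.reindex_bij_betw[OF permutes_imp_bij[OF p]])
  finally show ?thesis .
qed

text \<open>Merges two patterns that differ in the side of the descent on which the third letter
  stands: as \<open>P\<close> fails on both letters of the descent, the two sides account for every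
  letter satisfying \<open>P\<close>.\<close>

lemma card_outside_descent:
  assumes "i \<in> D" and "\<not> P (p i)" and "\<not> P (p (i + 1))"
  shows "card {k \<in> {1..n}. i + 1 < k \<and> P (p k)} + card {k \<in> {1..n}. k < i \<and> P (p k)}
    = card {v \<in> {1..n}. P v}"
proof -
  have "{k \<in> {1..n}. P (p k)}
      = {k \<in> {1..n}. i + 1 < k \<and> P (p k)} \<union> {k \<in> {1..n}. k < i \<and> P (p k)}"
  proof (intro equalityI subsetI)
    fix k assume k: "k \<in> {k \<in> {1..n}. P (p k)}"
    then have "k \<noteq> i" "k \<noteq> i + 1" using assms by auto
    then show "k \<in> {k \<in> {1..n}. i + 1 < k \<and> P (p k)} \<union> {k \<in> {1..n}. k < i \<and> P (p k)}"
      using k by auto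
  qed auto
  moreover have "{k \<in> {1..n}. i + 1 < k \<and> P (p k)} \<inter> {k \<in> {1..n}. k < i \<and> P (p k)} = {}"
    by auto
  ultimately show ?thesis
    using card_positions[of P] by (simp add: card_Un_disjoint)
qed

lemma occurrences_larger:
  "occurrences n 2 Adj 1 Dash 3 p + occurrences n 3 Dash 2 Adj 1 p
    = (\<Sum>i\<in>D. card {v \<in> {1..n}. p i < v})"
proof -
  have "occurrences n 2 Adj 1 Dash 3 p = (\<Sum>i\<in>D. card {k \<in> {1..n}. i + 1 < k \<and> p i < p k})"
    by (subst occurrences_Adj_Dash)
       (auto dest: descent_bounds(4) intro!: sum.cong arg_cong[where f = card])
  moreover have "occurrences n 3 Dash 2 Adj 1 p = (\<Sum>i\<in>D. card {k \<in> {1..n}. k < i \<and> p i < p k})"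
    by (subst occurrences_Dash_Adj)
       (auto simp: not_less_p dest: descent_bounds(4) intro!: sum.cong arg_cong[where f = card])
  moreover have "card {k \<in> {1..n}. i + 1 < k \<and> p i < p k}
      + card {k \<in> {1..n}. k < i \<and> p i < p k} = card {v \<in> {1..n}. p i < v}"
    if "i \<in> D" for i
    using descent_bounds(4)[OF that] by (intro card_outside_descent that) auto
  ultimately show ?thesis by (simp add: sum.distrib[symmetric])
qed

lemma occurrences_smaller:
  "occurrences n 1 Dash 3 Adj 2 p + occurrences n 3 Adj 2 Dash 1 p
    = (\<Sum>i\<in>D. card {v \<in> {1..n}. v < p (i + 1)})"
proof -
  have "occurrences n 1 Dash 3 Adj 2 p = (\<Sum>i\<in>D. card {k \<in> {1..n}. k < i \<and> p k < p (i + 1)})"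
    by (subst occurrences_Dash_Adj)
       (auto dest: descent_bounds(4) intro!: sum.cong arg_cong[where f = card])
  moreover have "occurrences n 3 Adj 2 Dash 1 p
      = (\<Sum>i\<in>D. card {k \<in> {1..n}. i + 1 < k \<and> p k < p (i + 1)})"
    by (subst occurrences_Adj_Dash)
       (auto simp: not_less_p dest: descent_bounds(4) intro!: sum.cong arg_cong[where f = card])
  moreover have "card {k \<in> {1..n}. i + 1 < k \<and> p k < p (i + 1)}
      + card {k \<in> {1..n}. k < i \<and> p k < p (i + 1)} = card {v \<in> {1..n}. v < p (i + 1)}"
    if "i \<in> D" for i
    using descent_bounds(4)[OF that] by (intro card_outside_descent that) auto
  ultimately show ?thesis by (simp add: sum.distrib[symmetric] add.commute)
qed

text \<open>Split the letters above a descent top into non-tops, which give \<open>A_EN\<close>, and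
  tops, which give the pairs of tops.\<close>

lemma larger_eq_A_EN:
  "(\<Sum>i\<in>D. card {v \<in> {1..n}. p i < v}) = A_EN n s + (des n p choose 2)"
proof -
  have "descent_tops n p \<subseteq> {1..n}"
    using p_bounds by (auto simp: tops_eq descents_def)
  from sum_card_outside(2)[OF _ this] show ?thesis
    by (simp add: tops_eq A_EN_eq des_def sum.reindex[OF inj_p] card_image[OF inj_p])
qed

lemma smaller_eq_A_NE:
  "(\<Sum>i\<in>D. card {v \<in> {1..n}. v < p (i + 1)}) = A_NE n s + (des n p choose 2)"
proof -
  have inj: "inj_on (\<lambda>i. p (i + 1)) D" by (auto simp: inj_on_def)
  have "descent_bottoms n p \<subseteq> {1..n}"
    using p_bounds by (auto simp: bottoms_eq descents_def)
  from sum_card_outside(1)[OF _ this] show ?thesis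
    by (simp add: bottoms_eq A_NE_eq des_def sum.reindex[OF inj, simplified]
        card_image[OF inj, simplified])
qed

end

theorem theorem24:
  fixes n :: nat and \<pi> \<sigma> :: "nat \<Rightarrow> nat"
  assumes "n \<ge> 1" and "\<pi> permutes {1..n}" and "\<sigma> = Psi n \<pi>"
  shows "(int (des n \<pi>) = int (wex n \<sigma>) - 1)
    \<and> (occurrences n 3 Adj 1 Dash 2 \<pi> = A_EE n \<sigma> + A_NN n \<sigma>)
    \<and> (int (occurrences n 2 Adj 1 Dash 3 \<pi>) + int (occurrences n 3 Dash 2 Adj 1 \<pi>)
           - int (des n \<pi> choose 2) = int (A_EN n \<sigma>))
    \<and> (occurrences n 2 Dash 3 Adj 1 \<pi> = C_EE n \<sigma> + C_NN n \<sigma>)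
    \<and> (int (occurrences n 1 Dash 3 Adj 2 \<pi>) + int (occurrences n 3 Adj 2 Dash 1 \<pi>)
           - int (des n \<pi> choose 2) = int (A_NE n \<sigma>))"
proof -
  note [simp] = assms(3)
  note thms = assms(1,2)
  show ?thesis
    using wex_eq[OF thms] A_eq_sum[OF thms] C_eq_sum[OF thms]
      occurrences_31_2[OF thms] occurrences_2_31[OF thms]
      occurrences_larger[OF thms] larger_eq_A_EN[OF thms]
      occurrences_smaller[OF thms] smaller_eq_A_NE[OF thms]
    by (simp flip: of_nat_add)
qed

end
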